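(* Let $p>2$ (with $p=\infty$ allowed). (i) If $2<p\le4$, then $C_{\mathbb R,2,p}\ge C_{\mathbb R,2,p}(2)=K_{2,\frac{p}{p-2},p}$, and $$ K_{2,\frac{p}{p-2},p}=\max_{\alpha\in[0,1]}\left[2\left|\frac{2\alpha^p-1}{\alpha^2+(1-\alpha^p)^{\frac2p}}\right|^{\frac{p}{p-2}}+\left(2\alpha(1-\alpha^p)^{\frac1p}\,\frac{\alpha^{p-2}+(1-\alpha^p)^{\frac{p-2}{p}}}{\alpha^2+(1-\alpha^p)^{\frac2p}}\right)^{\frac{p}{p-2}}\right]^{\frac{p-2}{p}}. $$ (ii) If $4\le p\le\infty$, then $D_{\mathbb R,2,p}\ge D_{\mathbb R,2,p}(2)=K_{2,\frac{4p}{3p-4},p}$ (where $\frac{4p}{3p-4}$ means $\frac43$ when $p=\infty$), and, for $4\le p<\infty$, $$ K_{2,\frac{4p}{3p-4},p}=\max_{\alpha\in[0,1]}\left[2\left|\frac{2\alpha^p-1}{\alpha^2+(1-\alpha^p)^{\frac2p}}\right|^{\frac{4p}{3p-4}}+\left(2\alpha(1-\alpha^p)^{\frac1p}\,\frac{\alpha^{p-2}+(1-\alpha^p)^{\frac{p-2}{p}}}{\alpha^2+(1-\alpha^p)^{\frac2p}}\right)^{\frac{4p}{3p-4}}\right]^{\frac{3p-4}{4p}}. $$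
   Context: For $n\in\mathbb N$, $\mathcal P(^2\mathbb R^n)$ is the space of real $2$-homogeneous polynomials $P(\mathbf x)=\sum_{|\alpha|=2}a_\alpha\mathbf x^\alpha$ on $\mathbb R^n$ (multi-indices $\alpha\in(\mathbb N\cup\{0\})^n$, $|\alpha|=\alpha_1+\cdots+\alpha_n$). For $1\le q<\infty$, $|P|_q=\left(\sum_{|\alpha|=2}|a_\alpha|^q\right)^{1/q}$. For $1\le p\le\infty$, $\|P\|_p=\sup\{|P(\mathbf x)|:\ \|\mathbf x\|_{\ell_p^n}\le1\}$. $K_{2,q,p}$ is the smallest $K>0$ such that $|P|_q\le K\|P\|_p$ for all $P\in\mathcal P(^2\mathbb R^2)$. For $2<p\le4$, $C_{\mathbb R,2,p}(n)$ is the smallest constant $C$ such that $|P|_{\frac{p}{p-2}}\le C\|P\|_p$ for all $P\in\mathcal P(^2\mathbb R^n)$, and $C_{\mathbb R,2,p}$ is the smallest constant for which this inequality holds for all $n\in\mathbb N$ and all $P\in\mathcal P(^2\mathbb R^n)$, i.e. $C_{\mathbb R,2,p}=\sup_n C_{\mathbb R,2,p}(n)$. For $4\le p\le\infty$, $D_{\mathbb R,2,p}(n)$ is the smallest constant $D$ such that $|P|_{\frac{4p}{3p-4}}\le D\|P\|_p$ for all $P\in\mathcal P(^2\mathbb R^n)$ (with $\frac{4p}{3p-4}=\frac43$ when $p=\infty$), and $D_{\mathbb R,2,p}=\sup_n D_{\mathbb R,2,p}(n)$ is the smallest constant for which this inequality holds for all $n\in\mathbb N$ and all $P\in\mathcal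 P(^2\mathbb R^n)$. (It is known that $C_{\mathbb R,2,p}$ and $D_{\mathbb R,2,p}$ are finite.) *)

theory Defs
  imports "HOL-Analysis.Analysis"
begin

text \<open>
  Vectors of \<open>\<real>\<^sup>n\<close> are functions \<open>nat \<Rightarrow> real\<close> of which only the entries with index
  \<open>i < n\<close> matter.  A multi-index is a function \<open>nat \<Rightarrow> nat\<close> vanishing at all \<open>i \<ge> n\<close>.
  A 2-homogeneous polynomial on \<open>\<real>\<^sup>n\<close> is given by its family \<open>a\<close> of real coefficients, of
  which only the entries at multi-indices of order 2 matter.  Exponents \<open>p\<close> with
  \<open>1 \<le> p \<le> \<infinity>\<close> have type \<^typ>\<open>ereal\<close>.
\<close>

definition multi_indices2 :: "nat \<Rightarrow> (nat \<Rightarrow> nat) set" where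
  "multi_indices2 n = {\<alpha>. (\<forall>i\<ge>n. \<alpha> i = 0) \<and> (\<Sum>i<n. \<alpha> i) = 2}"

lemma finite_multi_indices2: "finite (multi_indices2 n)"
proof (rule finite_subset)
  show "multi_indices2 n \<subseteq> {\<alpha>. \<forall>i. (i \<in> {..<n} \<longrightarrow> \<alpha> i \<in> {..2}) \<and> (i \<notin> {..<n} \<longrightarrow> \<alpha> i = 0)}"
  proof
    fix \<alpha> assume \<alpha>: "\<alpha> \<in> multi_indices2 n"
    have "\<alpha> i \<le> 2" if "i < n" for i
      using \<alpha> that member_le_sum[of i "{..<n}" \<alpha>] by (auto simp: multi_indices2_def)
    then show "\<alpha> \<in> {\<alpha>. \<forall>i. (i \<in> {..<n} \<longrightarrow> \<alpha> i \<in> {..2}) \<and> (i \<notin> {..<n} \<longrightarrow> \<alpha> i = 0)}"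
      using \<alpha> by (auto simp: multi_indices2_def)
  qed
  show "finite {\<alpha>::nat \<Rightarrow> nat. \<forall>i. (i \<in> {..<n} \<longrightarrow> \<alpha> i \<in> {..2}) \<and> (i \<notin> {..<n} \<longrightarrow> \<alpha> i = 0)}"
    by (intro finite_set_of_finite_funs) auto
qed

definition poly2_eval :: "nat \<Rightarrow> ((nat \<Rightarrow> nat) \<Rightarrow> real) \<Rightarrow> (nat \<Rightarrow> real) \<Rightarrow> real" where
  "poly2_eval n a x = (\<Sum>\<alpha>\<in>multi_indices2 n. a \<alpha> * (\<Prod>i<n. x i ^ \<alpha> i))"

definition coeff_norm :: "nat \<Rightarrow> real \<Rightarrow> ((nat \<Rightarrow> nat) \<Rightarrow> real) \<Rightarrow> real" where
  "coeff_norm n q a = (\<Sum>\<alpha>\<in>multi_indices2 n. \<bar>a \<alpha>\<bar> powr q) powr (1 / q)"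

text \<open>The norm of \<open>\<ell>\<^sub>p\<^sup>n\<close>, used only for \<open>n \<ge> 1\<close>.\<close>

definition lp_norm :: "nat \<Rightarrow> ereal \<Rightarrow> (nat \<Rightarrow> real) \<Rightarrow> real" where
  "lp_norm n p x =
     (if p = \<infinity> then Max ((\<lambda>i. \<bar>x i\<bar>) ` {..<n})
      else (\<Sum>i<n. \<bar>x i\<bar> powr real_of_ereal p) powr (1 / real_of_ereal p))"

definition poly2_norm :: "nat \<Rightarrow> ereal \<Rightarrow> ((nat \<Rightarrow> nat) \<Rightarrow> real) \<Rightarrow> real" where
  "poly2_norm n p a = (SUP x\<in>{x. lp_norm n p x \<le> 1}. \<bar>poly2_eval n a x\<bar>)"

definition K2 :: "real \<Rightarrow> ereal \<Rightarrow> real" where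
  "K2 q p = (LEAST K. K > 0 \<and> (\<forall>a. coeff_norm 2 q a \<le> K * poly2_norm 2 p a))"

text \<open>The exponents \<open>p / (p - 2)\<close> for \<open>2 < p \<le> 4\<close> and \<open>4 p / (3 p - 4)\<close> for
  \<open>4 \<le> p \<le> \<infinity>\<close>, the latter being \<open>4 / 3\<close> at \<open>p = \<infinity>\<close>.\<close>

definition C_exponent :: "ereal \<Rightarrow> real" where
  "C_exponent p = real_of_ereal p / (real_of_ereal p - 2)"

definition D_exponent :: "ereal \<Rightarrow> real" where
  "D_exponent p =
     (if p = \<infinity> then 4 / 3 else 4 * real_of_ereal p / (3 * real_of_ereal p - 4))"

definition C2_dim :: "ereal \<Rightarrow> nat \<Rightarrow> real" where
  "C2_dim p n = (LEAST C. \<forall>a. coeff_norm n (C_exponent p) a \<le> C * poly2_norm n p a)"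

definition D2_dim :: "ereal \<Rightarrow> nat \<Rightarrow> real" where
  "D2_dim p n = (LEAST D. \<forall>a. coeff_norm n (D_exponent p) a \<le> D * poly2_norm n p a)"

text \<open>The suprema over all dimensions are taken in \<^typ>\<open>ereal\<close>, where they exist
  independently of the known, but deep, fact that they are finite.\<close>

definition C2 :: "ereal \<Rightarrow> ereal" where
  "C2 p = (SUP n\<in>{1..}. ereal (C2_dim p n))"

definition D2 :: "ereal \<Rightarrow> ereal" where
  "D2 p = (SUP n\<in>{1..}. ereal (D2_dim p n))"

definition bracket :: "real \<Rightarrow> real \<Rightarrow> real \<Rightarrow> real" where
  "bracket p s \<alpha> =
     2 * \<bar>(2 * \<alpha> powr p - 1) / (\<alpha>\<^sup>2 + (1 - \<alpha> powr p) powr (2 / p))\<bar> powr s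
     + (2 * \<alpha> * (1 - \<alpha> powr p) powr (1 / p)
          * ((\<alpha> powr (p - 2) + (1 - \<alpha> powr p) powr ((p - 2) / p))
              / (\<alpha>\<^sup>2 + (1 - \<alpha> powr p) powr (2 / p)))) powr s"

definition is_max_on :: "('a \<Rightarrow> real) \<Rightarrow> 'a set \<Rightarrow> real \<Rightarrow> bool" where
  "is_max_on f A m \<longleftrightarrow> m \<in> f ` A \<and> (\<forall>x\<in>A. f x \<le> m)"

end

theory Submission
  imports Defs
begin

text \<open>
  For \<open>p < \<infinity>\<close> everything rests on the identity for \<open>K2\<close>, \<open>K2_is_max\<close>, which holds for
  every \<open>q \<ge> p / (p - 2)\<close>; both exponents of the theorem are of this kind.  The remaining claims
  hold because the constant for dimension two is \<open>K2\<close> without its positivity requirement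
  (\<open>K2_eq_LEAST\<close>), and is one of the members of the supremum over all dimensions.

  A form \<open>P = ax\<^sup>2 + by\<^sup>2 + cxy\<close> can be taken with \<open>c \<ge> 0\<close>, by \<open>y \<mapsto> -y\<close>.  Its norm \<open>M\<close> is then
  attained at a point \<open>(\<gamma>,\<delta>)\<close> of the unit circle in the first quadrant, up to replacing
  \<open>P(x,y)\<close> by \<open>-P(x,-y)\<close>, and there \<open>P\<close> is tangent to \<open>M\<parallel>\<cdot>\<parallel>\<^sub>p\<^sup>2\<close> (\<open>maximum_point\<close>).  The forms
  with this tangency make up a line,
  \<open>M(u(x\<^sup>2 - y\<^sup>2) + vxy) + t(\<delta>x - \<gamma>y)\<^sup>2\<close>, where \<open>u\<close> and \<open>v\<close> are exactly the quantities in
  \<open>bracket\<close> at \<open>\<alpha> = \<gamma>\<close> (\<open>tangent_decomposition\<close>).  Off the axes, where \<open>\<gamma>, \<delta> > 0\<close>, the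
  inequalities \<open>P \<ge> -M\<close> at \<open>(-\<delta>,\<gamma>)\<close> and \<open>c \<ge> 0\<close> show that \<open>P\<close> lies between \<open>M\<close> times the saddle
  form \<open>u(x\<^sup>2 - y\<^sup>2) + vxy\<close>, at \<open>t = 0\<close>, and the diagonal form
  \<open>M(\<gamma>\<^bsup>p-2\<^esup>x\<^sup>2 + \<delta>\<^bsup>p-2\<^esup>y\<^sup>2)\<close>.  Convexity of the coefficient sum then bounds it by its values at
  these two ends, and the diagonal form never wins because \<open>q(p - 2) \<ge> p\<close>
  (\<open>coefficient_sum_le_nonneg\<close>).

  For sharpness the saddle form must have norm \<open>1\<close> (\<open>saddle_norm_le\<close>).  The same analysis of the
  point where its norm is attained shows that it is a multiple of a saddle form of that
  point, and different points have saddle forms of different directions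
  (\<open>saddle_direction_injective\<close>).
\<close>

section \<open>Maximum points of a binary quadratic form on the \<open>\<ell>\<^sub>p\<close> sphere\<close>

text \<open>
  The part of the \<open>\<ell>\<^sub>p\<close> unit circle in the first quadrant.  The theorem describes its points by
  the first coordinate \<open>\<alpha>\<close>; carrying both coordinates keeps the roots \<open>(1 - \<alpha>\<^sup>p)\<^bsup>1/p\<^esup>\<close> out
  of the algebra.
\<close>

definition lp_arc :: "real \<Rightarrow> real \<Rightarrow> real \<Rightarrow> bool" where
  "lp_arc p \<gamma> \<delta> \<longleftrightarrow> 0 \<le> \<gamma> \<and> 0 \<le> \<delta> \<and> \<gamma> powr p + \<delta> powr p = 1"

lemma lp_arc_le_1:
  assumes "lp_arc p \<gamma> \<delta>" "p > 0"
  shows "\<gamma> \<le> 1" "\<delta> \<le> 1"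
proof -
  have *: "x \<le> 1" if "0 \<le> x" "x powr p \<le> 1" for x :: real
  proof (rule ccontr)
    assume "\<not> x \<le> 1"
    then have "1 powr p < x powr p" using assms(2) by (intro powr_less_mono2) auto
    then show False using that by simp
  qed
  show "\<gamma> \<le> 1" "\<delta> \<le> 1"
    using assms * powr_ge_zero[of \<gamma> p] powr_ge_zero[of \<delta> p] unfolding lp_arc_def by (smt (verit))+
qed

lemma lp_arc_iff:
  assumes "p > 0"
  shows "lp_arc p \<gamma> \<delta> \<longleftrightarrow> \<gamma> \<in> {0..1} \<and> \<delta> = (1 - \<gamma> powr p) powr (1 / p)"
proof
  assume L: "lp_arc p \<gamma> \<delta>"
  then have "1 - \<gamma> powr p = \<delta> powr p" by (auto simp: lp_arc_def)
  then have "(1 - \<gamma> powr p) powr (1 / p) = \<delta>"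
    using L assms by (simp add: powr_powr lp_arc_def)
  then show "\<gamma> \<in> {0..1} \<and> \<delta> = (1 - \<gamma> powr p) powr (1 / p)"
    using L lp_arc_le_1[OF L assms] by (auto simp: lp_arc_def)
next
  assume R: "\<gamma> \<in> {0..1} \<and> \<delta> = (1 - \<gamma> powr p) powr (1 / p)"
  then have "\<gamma> powr p \<le> 1"
    using assms by (simp add: powr_le1)
  then show "lp_arc p \<gamma> \<delta>"
    using R assms by (auto simp: lp_arc_def powr_powr)
qed

lemma lp_arc_swap: "lp_arc p \<gamma> \<delta> \<Longrightarrow> lp_arc p \<delta> \<gamma>"
  by (auto simp: lp_arc_def)

lemma powr_peel:
  assumes "(x::real) \<ge> 0"
  shows "x powr p = x * x powr (p - 1)" "x powr (p - 1) = x * x powr (p - 2)"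
  using powr_mult_base[OF assms, of "p - 1"] powr_mult_base[OF assms, of "p - 2"] by simp_all

lemma lp_arc_sum_squares_pos:
  assumes "lp_arc p \<gamma> \<delta>"
  shows "\<gamma>\<^sup>2 + \<delta>\<^sup>2 > 0"
  using assms by (auto simp: lp_arc_def sum_power2_gt_zero_iff)

lemma continuous_on_powr_unit:
  assumes "p > 0" "e > 0"
  shows "continuous_on {0..1} (\<lambda>t::real. t powr p)"
    "continuous_on {0..1} (\<lambda>t::real. (1 - t powr p) powr e)"
proof -
  show 1: "continuous_on {0..1} (\<lambda>t::real. t powr p)"
    by (rule continuous_on_powr'[OF continuous_on_id continuous_on_const]) (use assms in auto)
  show "continuous_on {0..1} (\<lambda>t::real. (1 - t powr p) powr e)"
    by (rule continuous_on_powr'[OF continuous_on_diff[OF continuous_on_const 1] continuous_on_const])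
       (use assms in \<open>simp add: powr_le1\<close>)
qed

text \<open>
  By homogeneity it suffices to bound the form on the unit circle, and for \<open>c \<ge> 0\<close> the arc in
  the first quadrant is enough.  Maximising \<open>\<bar>a\<gamma>\<^sup>2 + b\<delta>\<^sup>2\<bar> + c\<gamma>\<delta>\<close> there covers both signs of the
  form at once, because \<open>y \<mapsto> -y\<close> turns \<open>-(ax\<^sup>2 + by\<^sup>2 + cxy)\<close> into the form with coefficients
  \<open>-a, -b, c\<close>.
\<close>

lemma quadratic_form_le_lp_norm:
  assumes p: "p > 0" and c: "c \<ge> 0"
    and M: "\<And>\<gamma> \<delta>. lp_arc p \<gamma> \<delta> \<Longrightarrow> \<bar>a * \<gamma>\<^sup>2 + b * \<delta>\<^sup>2\<bar> + c * \<gamma> * \<delta> \<le> M"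
  shows "\<bar>a * x\<^sup>2 + b * y\<^sup>2 + c * x * y\<bar> \<le> M * (\<bar>x\<bar> powr p + \<bar>y\<bar> powr p) powr (2 / p)"
proof -
  define s where "s = (\<bar>x\<bar> powr p + \<bar>y\<bar> powr p) powr (1 / p)"
  have s2: "(\<bar>x\<bar> powr p + \<bar>y\<bar> powr p) powr (2 / p) = s\<^sup>2"
    using powr_powr[of "\<bar>x\<bar> powr p + \<bar>y\<bar> powr p" "1 / p" 2] by (simp add: s_def)
  have sp: "s powr p = \<bar>x\<bar> powr p + \<bar>y\<bar> powr p"
    using p by (simp add: s_def powr_powr)
  show ?thesis
  proof (cases "s = 0")
    case True
    with sp p have "\<bar>x\<bar> powr p + \<bar>y\<bar> powr p = 0" by simp
    then have "\<bar>x\<bar> powr p = 0" "\<bar>y\<bar> powr p = 0"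
      using powr_ge_zero[of "\<bar>x\<bar>" p] powr_ge_zero[of "\<bar>y\<bar>" p] by linarith+
    then have "x = 0" "y = 0" by simp_all
    then show ?thesis by simp
  next
    case False
    then have s: "s > 0" using powr_ge_zero by (auto simp: s_def less_le)
    have "lp_arc p (\<bar>x\<bar> / s) (\<bar>y\<bar> / s)"
      using s by (simp add: lp_arc_def powr_divide sp[symmetric] flip: add_divide_distrib)
    from M[OF this]
    have "\<bar>a * (\<bar>x\<bar> / s)\<^sup>2 + b * (\<bar>y\<bar> / s)\<^sup>2\<bar> + c * (\<bar>x\<bar> / s) * (\<bar>y\<bar> / s) \<le> M" .
    also have "a * (\<bar>x\<bar> / s)\<^sup>2 + b * (\<bar>y\<bar> / s)\<^sup>2 = (a * x\<^sup>2 + b * y\<^sup>2) / s\<^sup>2"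
      by (simp add: power_divide add_divide_distrib)
    also have "\<bar>(a * x\<^sup>2 + b * y\<^sup>2) / s\<^sup>2\<bar> = \<bar>a * x\<^sup>2 + b * y\<^sup>2\<bar> / s\<^sup>2"
      by (simp add: abs_divide)
    also have "c * (\<bar>x\<bar> / s) * (\<bar>y\<bar> / s) = (c * \<bar>x\<bar> * \<bar>y\<bar>) / s\<^sup>2"
      by (simp add: power2_eq_square)
    finally have "(\<bar>a * x\<^sup>2 + b * y\<^sup>2\<bar> + c * \<bar>x\<bar> * \<bar>y\<bar>) / s\<^sup>2 \<le> M"
      by (simp add: add_divide_distrib)
    then have "\<bar>a * x\<^sup>2 + b * y\<^sup>2\<bar> + c * \<bar>x\<bar> * \<bar>y\<bar> \<le> M * s\<^sup>2"
      using s by (simp add: pos_divide_le_eq)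
    moreover have "\<bar>a * x\<^sup>2 + b * y\<^sup>2 + c * x * y\<bar> \<le> \<bar>a * x\<^sup>2 + b * y\<^sup>2\<bar> + \<bar>c * x * y\<bar>"
      by (rule abs_triangle_ineq)
    moreover have "\<bar>c * x * y\<bar> = c * \<bar>x\<bar> * \<bar>y\<bar>" using c by (simp add: abs_mult)
    ultimately show ?thesis by (simp add: s2)
  qed
qed

text \<open>
  The gap \<open>M\<parallel>(x,y)\<parallel>\<^sub>p\<^sup>2 - (ax\<^sup>2 + by\<^sup>2 + cxy)\<close> is nonnegative and vanishes at \<open>(\<gamma>,\<delta>)\<close>, so its
  partial derivative in \<open>y\<close> vanishes there.  When \<open>\<delta> = 0\<close> a direct comparison replaces the
  derivative of \<open>\<bar>y\<bar>\<^sup>p\<close> at \<open>0\<close>: moving from \<open>(1,0)\<close> to \<open>(1,s)\<close> raises the squared norm only by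
  \<open>O(s\<^sup>p)\<close> and the form by \<open>cs + bs\<^sup>2\<close>, which forces \<open>c \<le> 0\<close> and hence \<open>c = 0\<close>.
\<close>

lemma first_order_condition:
  assumes p: "p > 2" and c: "c \<ge> 0" and arc: "lp_arc p \<gamma> \<delta>"
    and M: "a * \<gamma>\<^sup>2 + b * \<delta>\<^sup>2 + c * \<gamma> * \<delta> = M"
    and le: "\<And>x y. a * x\<^sup>2 + b * y\<^sup>2 + c * x * y \<le> M * (\<bar>x\<bar> powr p + \<bar>y\<bar> powr p) powr (2 / p)"
  shows "2 * b * \<delta> + c * \<gamma> = 2 * M * \<delta> powr (p - 1)"
proof (cases "\<delta> = 0")
  case False
  then have d: "\<delta> > 0" and g: "\<gamma> \<ge> 0" and gd: "\<gamma> powr p + \<delta> powr p = 1"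
    using arc by (auto simp: lp_arc_def)
  let ?G = "\<lambda>y. M * (\<gamma> powr p + y powr p) powr (2 / p) - (a * \<gamma>\<^sup>2 + b * y\<^sup>2 + c * \<gamma> * y)"
  have D: "DERIV ?G \<delta> :> 2 * M * \<delta> powr (p - 1) - (2 * b * \<delta> + c * \<gamma>)"
    using d gd p by (auto intro!: derivative_eq_intros simp: algebra_simps)
  have "\<forall>y. \<bar>\<delta> - y\<bar> < \<delta> \<longrightarrow> ?G \<delta> \<le> ?G y"
  proof (intro allI impI)
    fix y assume "\<bar>\<delta> - y\<bar> < \<delta>"
    then have "0 \<le> ?G y" using le[of \<gamma> y] g by simp
    moreover have "?G \<delta> = 0" using M gd by simp
    ultimately show "?G \<delta> \<le> ?G y" by simp
  qed
  with D d have "2 * M * \<delta> powr (p - 1) - (2 * b * \<delta> + c * \<gamma>) = 0"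
    by (rule DERIV_local_min)
  then show ?thesis by simp
next
  case True
  with arc p have g: "\<gamma> = 1"
    using lp_arc_iff[of p \<delta> \<gamma>] lp_arc_swap[OF arc] by auto
  have Ma: "M = a" using M True g by simp
  have *: "c \<le> \<bar>M\<bar> * s powr (p - 1) - b * s" if s: "0 < s" for s
  proof -
    have "M + b * s\<^sup>2 + c * s \<le> M * (1 + s powr p) powr (2 / p)"
      using le[of 1 s] s Ma by simp
    also have "\<dots> \<le> M + \<bar>M\<bar> * s powr p"
    proof -
      have 1: "1 \<le> (1 + s powr p) powr (2 / p)"
        using p by (intro ge_one_powr_ge_zero) auto
      \<comment> \<open>The exponent \<open>2 / p\<close> is below \<open>1\<close>, so the square of the norm of \<open>(1,s)\<close> is at most \<open>1 + s\<^sup>p\<close>.\<close>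
      have 2: "(1 + s powr p) powr (2 / p) \<le> (1 + s powr p) powr 1"
        using p by (intro powr_mono) auto
      have "M * ((1 + s powr p) powr (2 / p) - 1) \<le> \<bar>M\<bar> * ((1 + s powr p) powr (2 / p) - 1)"
        using 1 by (intro mult_right_mono) auto
      also have "\<dots> \<le> \<bar>M\<bar> * s powr p"
        using 2 by (intro mult_left_mono) auto
      finally show ?thesis by (simp add: algebra_simps)
    qed
    finally have "s * c \<le> s * (\<bar>M\<bar> * s powr (p - 1) - b * s)"
      using powr_peel(1)[of s p] s by (simp add: algebra_simps power2_eq_square)
    then show ?thesis using s by simp
  qed
  have "((\<lambda>s. \<bar>M\<bar> * s powr (p - 1) - b * s) \<longlongrightarrow> \<bar>M\<bar> * 0 powr (p - 1) - b * 0) (at_right 0)"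
    using p by (intro tendsto_intros tendsto_powr2) (auto simp: eventually_at_filter)
  then have "c \<le> \<bar>M\<bar> * 0 powr (p - 1) - b * 0"
    by (rule tendsto_lowerbound)
       (use * in \<open>auto simp: eventually_at_right_less intro: eventually_at_rightI[of 0 1]\<close>)
  then show ?thesis using c True by simp
qed

text \<open>
  The sign \<open>\<sigma>\<close> records whether the norm is attained as a maximum of the form or, after
  \<open>y \<mapsto> -y\<close>, as a maximum of its negative.
\<close>

lemma maximum_point:
  assumes p: "p > 2" and c: "c \<ge> 0"
  obtains \<gamma> \<delta> M \<sigma> where "lp_arc p \<gamma> \<delta>" "\<sigma> = 1 \<or> \<sigma> = -1" "M \<ge> 0"
    "\<sigma> * (a * \<gamma>\<^sup>2 + b * \<delta>\<^sup>2) + c * \<gamma> * \<delta> = M"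
    "\<And>x y. \<bar>a * x\<^sup>2 + b * y\<^sup>2 + c * x * y\<bar> \<le> M * (\<bar>x\<bar> powr p + \<bar>y\<bar> powr p) powr (2 / p)"
    "2 * (\<sigma> * a) * \<gamma> + c * \<delta> = 2 * M * \<gamma> powr (p - 1)"
    "2 * (\<sigma> * b) * \<delta> + c * \<gamma> = 2 * M * \<delta> powr (p - 1)"
proof -
  define f where "f = (\<lambda>\<gamma> \<delta>. \<bar>a * \<gamma>\<^sup>2 + b * \<delta>\<^sup>2\<bar> + c * \<gamma> * \<delta>)"
  have "continuous_on {0..1} (\<lambda>t. f t ((1 - t powr p) powr (1 / p)))"
    unfolding f_def using p
    by (intro continuous_on_add continuous_on_rabs continuous_on_mult continuous_on_power
        continuous_on_const continuous_on_id continuous_on_powr_unit) simp_all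
  from continuous_attains_sup[OF _ _ this] obtain \<gamma> where
    \<gamma>: "\<gamma> \<in> {0..1}" "\<And>t. t \<in> {0..1} \<Longrightarrow>
      f t ((1 - t powr p) powr (1 / p)) \<le> f \<gamma> ((1 - \<gamma> powr p) powr (1 / p))" by auto
  define \<delta> where "\<delta> = (1 - \<gamma> powr p) powr (1 / p)"
  define M where "M = f \<gamma> \<delta>"
  define \<sigma> :: real where "\<sigma> = (if a * \<gamma>\<^sup>2 + b * \<delta>\<^sup>2 \<ge> 0 then 1 else -1)"
  have arc: "lp_arc p \<gamma> \<delta>" using \<gamma>(1) p by (simp add: lp_arc_iff \<delta>_def)
  have \<sigma>: "\<sigma> = 1 \<or> \<sigma> = -1" by (simp add: \<sigma>_def)
  have M: "M \<ge> 0" using c arc by (simp add: M_def f_def lp_arc_def)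
  have max: "\<bar>a * x\<^sup>2 + b * y\<^sup>2\<bar> + c * x * y \<le> M" if "lp_arc p x y" for x y
    using that \<gamma>(2)[of x] p by (simp add: lp_arc_iff M_def \<delta>_def f_def)
  have eq: "(\<sigma> * a) * \<gamma>\<^sup>2 + (\<sigma> * b) * \<delta>\<^sup>2 + c * \<gamma> * \<delta> = M"
    by (auto simp: M_def f_def \<sigma>_def)
  have bd: "\<bar>(\<sigma> * a) * x\<^sup>2 + (\<sigma> * b) * y\<^sup>2 + c * x * y\<bar> \<le> M * (\<bar>x\<bar> powr p + \<bar>y\<bar> powr p) powr (2 / p)" for x y
  proof (rule quadratic_form_le_lp_norm[OF _ c])
    fix x y assume "lp_arc p x y"
    from max[OF this] show "\<bar>\<sigma> * a * x\<^sup>2 + \<sigma> * b * y\<^sup>2\<bar> + c * x * y \<le> M"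
      using \<sigma> by (auto simp: abs_minus_commute)
  qed (use p in auto)
  have "2 * (\<sigma> * b) * \<delta> + c * \<gamma> = 2 * M * \<delta> powr (p - 1)"
    using first_order_condition[OF p c arc eq] bd by (simp add: abs_le_iff)
  moreover have "2 * (\<sigma> * a) * \<gamma> + c * \<delta> = 2 * M * \<gamma> powr (p - 1)"
  proof (rule first_order_condition[OF p c lp_arc_swap[OF arc]])
    show "\<sigma> * b * \<delta>\<^sup>2 + \<sigma> * a * \<gamma>\<^sup>2 + c * \<delta> * \<gamma> = M" using eq by (simp add: algebra_simps)
    show "\<sigma> * b * x\<^sup>2 + \<sigma> * a * y\<^sup>2 + c * x * y \<le> M * (\<bar>x\<bar> powr p + \<bar>y\<bar> powr p) powr (2 / p)" for x y
      using bd[of y x] by (simp add: abs_le_iff algebra_simps)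
  qed
  moreover have "\<bar>a * x\<^sup>2 + b * y\<^sup>2 + c * x * y\<bar> \<le> M * (\<bar>x\<bar> powr p + \<bar>y\<bar> powr p) powr (2 / p)" for x y
    using p c max by (intro quadratic_form_le_lp_norm) auto
  moreover have "\<sigma> * (a * \<gamma>\<^sup>2 + b * \<delta>\<^sup>2) + c * \<gamma> * \<delta> = M" using eq by (simp add: algebra_simps)
  ultimately show thesis using that[OF arc \<sigma> M] by blast
qed

section \<open>The extremal forms\<close>

text \<open>
  The form \<open>u(x\<^sup>2 - y\<^sup>2) + vxy\<close> with \<open>u = saddle_a p \<gamma> \<delta>\<close> and \<open>v = saddle_c p \<gamma> \<delta>\<close> is the only form
  with opposite square coefficients that is tangent to \<open>\<parallel>\<cdot>\<parallel>\<^sub>p\<^sup>2\<close> at \<open>(\<gamma>,\<delta>)\<close>.  It changes sign under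
  the quarter turn \<open>(x,y) \<mapsto> (-y,x)\<close>, so it takes the value \<open>1\<close> at \<open>(\<gamma>,\<delta>)\<close> and \<open>-1\<close> at
  \<open>(-\<delta>,\<gamma>)\<close>.
\<close>

definition saddle_a :: "real \<Rightarrow> real \<Rightarrow> real \<Rightarrow> real" where
  "saddle_a p \<gamma> \<delta> = (\<gamma> powr p - \<delta> powr p) / (\<gamma>\<^sup>2 + \<delta>\<^sup>2)"

definition saddle_c :: "real \<Rightarrow> real \<Rightarrow> real \<Rightarrow> real" where
  "saddle_c p \<gamma> \<delta> = 2 * \<gamma> * \<delta> * (\<gamma> powr (p - 2) + \<delta> powr (p - 2)) / (\<gamma>\<^sup>2 + \<delta>\<^sup>2)"

lemma bracket_eq_saddle:
  assumes p: "p > 0" and arc: "lp_arc p \<gamma> \<delta>"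
  shows "bracket p q \<gamma> = 2 * \<bar>saddle_a p \<gamma> \<delta>\<bar> powr q + \<bar>saddle_c p \<gamma> \<delta>\<bar> powr q"
proof -
  have nn: "\<gamma> \<ge> 0" "\<delta> \<ge> 0" and e: "1 - \<gamma> powr p = \<delta> powr p" "2 * \<gamma> powr p - 1 = \<gamma> powr p - \<delta> powr p"
    using arc by (auto simp: lp_arc_def)
  have "(\<delta> powr p) powr (2 / p) = \<delta>\<^sup>2" "(\<delta> powr p) powr (1 / p) = \<delta>"
    "(\<delta> powr p) powr ((p - 2) / p) = \<delta> powr (p - 2)"
    using p nn by (simp_all add: powr_powr)
  moreover have "\<bar>saddle_c p \<gamma> \<delta>\<bar> = saddle_c p \<gamma> \<delta>" 
    unfolding saddle_c_def using nn by (intro abs_of_nonneg) simp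
  ultimately show ?thesis
    unfolding bracket_def e by (simp only: saddle_a_def saddle_c_def times_divide_eq_right)
qed

lemma saddle_c_eq:
  assumes "lp_arc p \<gamma> \<delta>"
  shows "saddle_c p \<gamma> \<delta> = 2 * (\<gamma> powr (p - 1) * \<delta> + \<gamma> * \<delta> powr (p - 1)) / (\<gamma>\<^sup>2 + \<delta>\<^sup>2)"
proof -
  have "\<gamma> \<ge> 0" "\<delta> \<ge> 0" using assms by (auto simp: lp_arc_def)
  then show ?thesis
    using powr_peel(2)[of \<gamma> p] powr_peel(2)[of \<delta> p] by (simp add: saddle_c_def algebra_simps)
qed

lemma saddle_at_point:
  assumes arc: "lp_arc p \<gamma> \<delta>"
  shows "saddle_a p \<gamma> \<delta> * (\<gamma>\<^sup>2 - \<delta>\<^sup>2) + saddle_c p \<gamma> \<delta> * \<gamma> * \<delta> = 1"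
proof -
  have nn: "\<gamma> \<ge> 0" "\<delta> \<ge> 0" and e: "\<gamma> powr p + \<delta> powr p = 1"
    using arc by (auto simp: lp_arc_def)
  have pos: "\<gamma>\<^sup>2 + \<delta>\<^sup>2 > 0" using arc by (rule lp_arc_sum_squares_pos)
  have g: "\<gamma> powr p = \<gamma> * \<gamma> powr (p - 1)" and d: "\<delta> powr p = \<delta> * \<delta> powr (p - 1)"
    by (rule powr_peel(1)[OF nn(1)], rule powr_peel(1)[OF nn(2)])
  have "(\<gamma> powr p - \<delta> powr p) * (\<gamma>\<^sup>2 - \<delta>\<^sup>2)
      + 2 * (\<gamma> powr (p - 1) * \<delta> + \<gamma> * \<delta> powr (p - 1)) * \<gamma> * \<delta>
      = (\<gamma>\<^sup>2 + \<delta>\<^sup>2) * (\<gamma> powr p + \<delta> powr p)"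
    unfolding g d by (simp add: algebra_simps power2_eq_square)
  then have *: "(\<gamma> powr p - \<delta> powr p) * (\<gamma>\<^sup>2 - \<delta>\<^sup>2)
      + 2 * (\<gamma> powr (p - 1) * \<delta> + \<gamma> * \<delta> powr (p - 1)) * \<gamma> * \<delta> = \<gamma>\<^sup>2 + \<delta>\<^sup>2" by (simp add: e)
  have "saddle_a p \<gamma> \<delta> * (\<gamma>\<^sup>2 - \<delta>\<^sup>2) + saddle_c p \<gamma> \<delta> * \<gamma> * \<delta>
    = ((\<gamma> powr p - \<delta> powr p) * (\<gamma>\<^sup>2 - \<delta>\<^sup>2)
      + 2 * (\<gamma> powr (p - 1) * \<delta> + \<gamma> * \<delta> powr (p - 1)) * \<gamma> * \<delta>) / (\<gamma>\<^sup>2 + \<delta>\<^sup>2)"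
    by (simp only: saddle_a_def saddle_c_eq[OF arc] add_divide_distrib times_divide_eq_left)
  also have "\<dots> = 1" unfolding * using pos by (metis divide_self less_irrefl)
  finally show ?thesis .
qed

text \<open>
  The gradient at \<open>(\<gamma>,\<delta>)\<close>, which for a form determines the value there, imposes two linear
  conditions on three coefficients, so the forms tangent to \<open>M\<parallel>\<cdot>\<parallel>\<^sub>p\<^sup>2\<close> at that point make up a line.  The saddle form, scaled by \<open>M\<close>, lies on it,
  and \<open>(\<delta>x - \<gamma>y)\<^sup>2\<close>, which vanishes to second order at \<open>(\<gamma>,\<delta>)\<close>, spans its direction.
\<close>

lemma tangent_decomposition:
  assumes arc: "lp_arc p \<gamma> \<delta>"
    and x: "2 * a * \<gamma> + c * \<delta> = 2 * M * \<gamma> powr (p - 1)"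
    and y: "2 * b * \<delta> + c * \<gamma> = 2 * M * \<delta> powr (p - 1)"
  obtains t where "a = M * saddle_a p \<gamma> \<delta> + t * \<delta>\<^sup>2" "b = - (M * saddle_a p \<gamma> \<delta>) + t * \<gamma>\<^sup>2"
    "c = M * saddle_c p \<gamma> \<delta> - 2 * t * \<gamma> * \<delta>" "a + b = t * (\<gamma>\<^sup>2 + \<delta>\<^sup>2)"
proof -
  define s where "s = \<gamma>\<^sup>2 + \<delta>\<^sup>2"
  define t where "t = (a + b) / s"
  have s: "s > 0" using lp_arc_sum_squares_pos[OF arc] by (simp add: s_def)
  have t: "t * s = a + b" using s by (simp add: t_def)
  have nn: "\<gamma> \<ge> 0" "\<delta> \<ge> 0" using arc by (auto simp: lp_arc_def)
  define A where "A = saddle_a p \<gamma> \<delta>"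
  have A: "A * s = \<gamma> * \<gamma> powr (p - 1) - \<delta> * \<delta> powr (p - 1)"
    using s nn powr_peel(1)[of \<gamma> p] powr_peel(1)[of \<delta> p] by (simp add: saddle_a_def s_def A_def)
  define C where "C = saddle_c p \<gamma> \<delta>"
  have C: "C * s = 2 * (\<gamma> powr (p - 1) * \<delta> + \<gamma> * \<delta> powr (p - 1))"
    using s by (simp add: saddle_c_eq[OF arc] s_def C_def)
  define g d where gd: "g = \<gamma> powr (p - 1)" "d = \<delta> powr (p - 1)"
  note facts = A[folded gd] C[folded gd] x[folded gd] y[folded gd] t s_def
  have "a * s = (M * A + t * \<delta>\<^sup>2) * s" using facts by algebra
  then have 1: "a = M * A + t * \<delta>\<^sup>2" using s by simp
  have "b * s = (- (M * A) + t * \<gamma>\<^sup>2) * s" using facts by algebra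
  then have 2: "b = - (M * A) + t * \<gamma>\<^sup>2" using s by simp
  have "c * s = (M * C - 2 * t * \<gamma> * \<delta>) * s" using facts by algebra
  then have 3: "c = M * C - 2 * t * \<gamma> * \<delta>" using s by simp
  show thesis
    by (rule that[OF 1[unfolded A_def] 2[unfolded A_def] 3[unfolded C_def] t[symmetric, unfolded s_def]])
qed

text \<open>
  Distinct points of the arc have saddle forms of distinct directions.  Clearing denominators,
  proportionality of the forms at \<open>(\<alpha>,\<beta>)\<close> and \<open>(\<gamma>,\<delta>)\<close> says that
    \<open>((\<alpha>\<gamma>)\<^bsup>p-1\<^esup> + (\<beta>\<delta>)\<^bsup>p-1\<^esup>)(\<gamma>\<beta> - \<alpha>\<delta>) + (\<alpha>\<gamma> + \<beta>\<delta>)((\<gamma>\<beta>)\<^bsup>p-1\<^esup> - (\<alpha>\<delta>)\<^bsup>p-1\<^esup>) = 0\<close>.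
  Both summands have the sign of \<open>\<gamma>\<beta> - \<alpha>\<delta>\<close>.  Hence the points are parallel, and so equal, unless
  they are the two end points of the arc, whose forms are negatives of each other.  At a common
  point both forms take the value \<open>1\<close>.
\<close>

lemma saddle_direction_injective:
  assumes p: "p > 1" and arc: "lp_arc p \<alpha> \<beta>" "lp_arc p \<gamma> \<delta>" and M: "M > 0"
    and a: "saddle_a p \<alpha> \<beta> = M * saddle_a p \<gamma> \<delta>"
    and c: "saddle_c p \<alpha> \<beta> = M * saddle_c p \<gamma> \<delta>"
  shows "M = 1"
proof -
  have nn: "\<alpha> \<ge> 0" "\<beta> \<ge> 0" "\<gamma> \<ge> 0" "\<delta> \<ge> 0" and e: "\<alpha> powr p + \<beta> powr p = 1" "\<gamma> powr p + \<delta> powr p = 1"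
    using arc by (auto simp: lp_arc_def)
  have pos: "\<alpha>\<^sup>2 + \<beta>\<^sup>2 > 0" "\<gamma>\<^sup>2 + \<delta>\<^sup>2 > 0" using arc by (auto intro: lp_arc_sum_squares_pos)
  define w x y z where wx: "w = \<alpha> powr (p - 1)" "x = \<beta> powr (p - 1)" "y = \<gamma> powr (p - 1)" "z = \<delta> powr (p - 1)"
  have "saddle_a p \<alpha> \<beta> * saddle_c p \<gamma> \<delta> = saddle_c p \<alpha> \<beta> * saddle_a p \<gamma> \<delta>"
    by (simp add: a c)
  moreover have "saddle_a p \<alpha> \<beta> * (\<alpha>\<^sup>2 + \<beta>\<^sup>2) = \<alpha> powr p - \<beta> powr p"
    "saddle_a p \<gamma> \<delta> * (\<gamma>\<^sup>2 + \<delta>\<^sup>2) = \<gamma> powr p - \<delta> powr p"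
    "saddle_c p \<alpha> \<beta> * (\<alpha>\<^sup>2 + \<beta>\<^sup>2) = 2 * (w * \<beta> + \<alpha> * x)"
    "saddle_c p \<gamma> \<delta> * (\<gamma>\<^sup>2 + \<delta>\<^sup>2) = 2 * (y * \<delta> + \<gamma> * z)"
    unfolding saddle_c_eq[OF arc(1)] saddle_c_eq[OF arc(2)] saddle_a_def wx
    using pos by (metis nonzero_eq_divide_eq less_irrefl)+
  ultimately have "(\<alpha> powr p - \<beta> powr p) * (y * \<delta> + \<gamma> * z) = (w * \<beta> + \<alpha> * x) * (\<gamma> powr p - \<delta> powr p)"
    by algebra
  then have cross: "(\<alpha> * w - \<beta> * x) * (y * \<delta> + \<gamma> * z) = (w * \<beta> + \<alpha> * x) * (\<gamma> * y - \<delta> * z)"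
    by (simp only: powr_peel(1)[OF nn(1), of p] powr_peel(1)[OF nn(2), of p]
        powr_peel(1)[OF nn(3), of p] powr_peel(1)[OF nn(4), of p] wx)
  \<comment> \<open>The difference of the two sides, regrouped so that both summands have the same sign.\<close>
  have "(w * y + x * z) * (\<gamma> * \<beta> - \<alpha> * \<delta>) + (\<alpha> * \<gamma> + \<beta> * \<delta>) * (y * x - w * z) = 0"
    using cross by algebra
  moreover have "y * x = (\<gamma> * \<beta>) powr (p - 1)" "w * z = (\<alpha> * \<delta>) powr (p - 1)"
    by (simp_all add: wx powr_mult)
  ultimately have cross': "(w * y + x * z) * (\<gamma> * \<beta> - \<alpha> * \<delta>)
      + (\<alpha> * \<gamma> + \<beta> * \<delta>) * ((\<gamma> * \<beta>) powr (p - 1) - (\<alpha> * \<delta>) powr (p - 1)) = 0" by simp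
  have wn: "w * y + x * z \<ge> 0" "\<alpha> * \<gamma> + \<beta> * \<delta> \<ge> 0" using nn by (simp_all add: wx)
  have orth: "\<alpha> * \<gamma> + \<beta> * \<delta> = 0" if ne: "\<gamma> * \<beta> \<noteq> \<alpha> * \<delta>"
  proof (cases "\<alpha> * \<delta> < \<gamma> * \<beta>")
    case True
    then have "(\<alpha> * \<delta>) powr (p - 1) < (\<gamma> * \<beta>) powr (p - 1)"
      using nn p by (intro powr_less_mono2) auto
    moreover have "(w * y + x * z) * (\<gamma> * \<beta> - \<alpha> * \<delta>) \<ge> 0" using True wn by simp
    ultimately show ?thesis using cross' wn by (smt (verit) mult_pos_pos)
  next
    case False
    then have lt: "\<gamma> * \<beta> < \<alpha> * \<delta>" using ne by simp
    then have "(\<gamma> * \<beta>) powr (p - 1) < (\<alpha> * \<delta>) powr (p - 1)"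
      using nn p by (intro powr_less_mono2) auto
    moreover have "(w * y + x * z) * (\<gamma> * \<beta> - \<alpha> * \<delta>) \<le> 0" using lt wn by (simp add: mult_le_0_iff)
    ultimately show ?thesis using cross' wn by (smt (verit) mult_pos_neg)
  qed
  have par: "\<gamma> * \<beta> = \<alpha> * \<delta>"
  proof (rule ccontr)
    assume ne: "\<gamma> * \<beta> \<noteq> \<alpha> * \<delta>"
    then have "\<alpha> * \<gamma> + \<beta> * \<delta> = 0" by (rule orth)
    then have "\<alpha> * \<gamma> = 0" "\<beta> * \<delta> = 0" using nn by (smt (verit) mult_nonneg_nonneg)+
    with ne consider "\<alpha> = 0" "\<delta> = 0" "\<beta> > 0" "\<gamma> > 0" | "\<gamma> = 0" "\<beta> = 0" "\<alpha> > 0" "\<delta> > 0"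
      using nn by fastforce
    then show False
    proof cases
      case 1
      then have "saddle_a p \<alpha> \<beta> < 0" "M * saddle_a p \<gamma> \<delta> > 0" using M by (auto simp: saddle_a_def)
      then show False using a by simp
    next
      case 2
      then have "saddle_a p \<alpha> \<beta> > 0" "M * saddle_a p \<gamma> \<delta> < 0"
        using M by (auto simp: saddle_a_def mult_less_0_iff)
      then show False using a by simp
    qed
  qed
  have "(\<gamma> * \<beta>) powr p = (\<alpha> * \<delta>) powr p" by (simp add: par)
  then have "\<gamma> powr p * \<beta> powr p = \<alpha> powr p * \<delta> powr p" by (simp add: powr_mult)
  then have "\<gamma> powr p = \<alpha> powr p" using e by algebra
  moreover from this have "\<delta> powr p = \<beta> powr p" using e by simp
  ultimately have "(\<gamma> powr p) powr (1 / p) = (\<alpha> powr p) powr (1 / p)"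
    "(\<delta> powr p) powr (1 / p) = (\<beta> powr p) powr (1 / p)" by simp_all
  then have eqs: "\<gamma> = \<alpha>" "\<delta> = \<beta>" using nn p by (simp_all add: powr_powr)
  have "M * (saddle_a p \<alpha> \<beta> * (\<alpha>\<^sup>2 - \<beta>\<^sup>2) + saddle_c p \<alpha> \<beta> * \<alpha> * \<beta>)
      = saddle_a p \<alpha> \<beta> * (\<alpha>\<^sup>2 - \<beta>\<^sup>2) + saddle_c p \<alpha> \<beta> * \<alpha> * \<beta>"
    using a[unfolded eqs] c[unfolded eqs] by algebra
  then show "M = 1" by (simp add: saddle_at_point[OF arc(1)])
qed

lemma saddle_swap: "saddle_a p \<delta> \<gamma> = - saddle_a p \<gamma> \<delta>" "saddle_c p \<delta> \<gamma> = saddle_c p \<gamma> \<delta>"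
  unfolding saddle_a_def saddle_c_def by (simp_all add: minus_divide_left add.commute mult.commute mult.left_commute)

text \<open>
  The norm \<open>M\<close> of a saddle form is attained at some \<open>(\<gamma>,\<delta>)\<close>, where
  \<open>tangent_decomposition\<close> applies.  As its square coefficients are opposite, the multiple \<open>t\<close> of
  \<open>(\<delta>x - \<gamma>y)\<^sup>2\<close> is zero, so the form is \<open>M\<close> times the saddle form of \<open>(\<gamma>,\<delta>)\<close> (or of
  \<open>(\<delta>,\<gamma>)\<close>, if the sign \<open>\<sigma>\<close> is \<open>-1\<close>); injectivity of the direction leaves only \<open>M = 1\<close>.
\<close>

lemma saddle_norm_le:
  assumes p: "p > 2" and arc: "lp_arc p \<alpha> \<beta>"
  shows "\<bar>saddle_a p \<alpha> \<beta> * x\<^sup>2 + - saddle_a p \<alpha> \<beta> * y\<^sup>2 + saddle_c p \<alpha> \<beta> * x * y\<bar>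
    \<le> (\<bar>x\<bar> powr p + \<bar>y\<bar> powr p) powr (2 / p)"
proof -
  let ?a = "saddle_a p \<alpha> \<beta>" and ?c = "saddle_c p \<alpha> \<beta>"
  have nn: "\<alpha> \<ge> 0" "\<beta> \<ge> 0" and e: "\<alpha> powr p + \<beta> powr p = 1"
    using arc by (auto simp: lp_arc_def)
  have "?c \<ge> 0" using nn by (simp add: saddle_c_def)
  then obtain \<gamma> \<delta> M \<sigma> where
    arc': "lp_arc p \<gamma> \<delta>" and \<sigma>: "\<sigma> = 1 \<or> \<sigma> = -1" and
    le: "\<And>x y. \<bar>?a * x\<^sup>2 + - ?a * y\<^sup>2 + ?c * x * y\<bar> \<le> M * (\<bar>x\<bar> powr p + \<bar>y\<bar> powr p) powr (2 / p)" and
    eqs: "2 * (\<sigma> * ?a) * \<gamma> + ?c * \<delta> = 2 * M * \<gamma> powr (p - 1)"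
    "2 * (\<sigma> * - ?a) * \<delta> + ?c * \<gamma> = 2 * M * \<delta> powr (p - 1)"
    by (rule maximum_point[OF p]) (rule that, assumption+)
  have "?a * \<alpha>\<^sup>2 + - ?a * \<beta>\<^sup>2 + ?c * \<alpha> * \<beta> = 1"
    using saddle_at_point[OF arc] by (simp add: algebra_simps)
  with le[of \<alpha> \<beta>] have M: "M > 0" using nn e by simp
  have s: "\<gamma>\<^sup>2 + \<delta>\<^sup>2 > 0" using arc' by (rule lp_arc_sum_squares_pos)
  from tangent_decomposition[OF arc' eqs] obtain t where
    "\<sigma> * ?a = M * saddle_a p \<gamma> \<delta> + t * \<delta>\<^sup>2" "?c = M * saddle_c p \<gamma> \<delta> - 2 * t * \<gamma> * \<delta>"
    "\<sigma> * ?a + \<sigma> * - ?a = t * (\<gamma>\<^sup>2 + \<delta>\<^sup>2)" by metis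
  then have ac: "\<sigma> * ?a = M * saddle_a p \<gamma> \<delta>" "?c = M * saddle_c p \<gamma> \<delta>"
    using s by auto
  have "M = 1"
    using \<sigma>
  proof
    assume "\<sigma> = 1"
    then show ?thesis using saddle_direction_injective[OF _ arc arc' M] ac p by simp
  next
    assume "\<sigma> = -1"
    then have "?a = M * saddle_a p \<delta> \<gamma>" "?c = M * saddle_c p \<delta> \<gamma>"
      unfolding saddle_swap[of p \<delta> \<gamma>] using ac by auto
    then show ?thesis
      using saddle_direction_injective[OF _ arc lp_arc_swap[OF arc'] M] p by simp
  qed
  then show ?thesis using le[of x y] by simp
qed

section \<open>The coefficient inequality\<close>

lemma abs_powr_convex:
  assumes q: "q \<ge> (1::real)" and l: "0 \<le> l" "l \<le> 1"
  shows "\<bar>(1 - l) * x + l * y\<bar> powr q \<le> (1 - l) * \<bar>x\<bar> powr q + l * \<bar>y\<bar> powr q"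
proof -
  have 0: "(k * z) powr q \<le> k * z powr q" if "0 \<le> k" "k \<le> 1" "z \<ge> 0" for k z :: real
  proof -
    have "k powr q \<le> k powr 1" using that q by (intro powr_mono') auto
    then have "k powr q * z powr q \<le> k * z powr q" using that by (intro mult_right_mono) auto
    then show ?thesis by (simp add: powr_mult)
  qed
  have conv: "((1 - l) * u + l * v) powr q \<le> (1 - l) * u powr q + l * v powr q"
    if "u \<ge> 0" "v \<ge> 0" for u v :: real
  proof (cases "u = 0 \<or> v = 0")
    case True
    then show ?thesis using 0[of l v] 0[of "1 - l" u] that l by auto
  next
    case False
    then show ?thesis
      using convex_onD[OF powr_convex[OF q], of l u v] that l by simp
  qed
  have "\<bar>(1 - l) * x + l * y\<bar> \<le> (1 - l) * \<bar>x\<bar> + l * \<bar>y\<bar>"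
    using abs_triangle_ineq[of "(1 - l) * x" "l * y"] l by (simp add: abs_mult)
  then have "\<bar>(1 - l) * x + l * y\<bar> powr q \<le> ((1 - l) * \<bar>x\<bar> + l * \<bar>y\<bar>) powr q"
    using q by (intro powr_mono2) auto
  also have "\<dots> \<le> (1 - l) * \<bar>x\<bar> powr q + l * \<bar>y\<bar> powr q" by (intro conv) auto
  finally show ?thesis .
qed

lemma bracket_one: "bracket p q 1 = 2"
  by (simp add: bracket_def)

text \<open>
  Write the form, up to the sign \<open>\<sigma>\<close>, as the scaled saddle form at its maximum point plus
  \<open>t(\<delta>x - \<gamma>y)\<^sup>2\<close>.  The value at \<open>(-\<delta>,\<gamma>)\<close>, which is \<open>-M + t(\<gamma>\<^sup>2 + \<delta>\<^sup>2)\<^sup>2\<close> and cannot be less than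
  \<open>-M\<close>, gives \<open>t \<ge> 0\<close>; the condition \<open>c \<ge> 0\<close> gives \<open>t \<le> t\<^sub>1\<close>, where \<open>t\<^sub>1\<close> is the parameter that
  makes the mixed coefficient vanish.  At \<open>t\<^sub>1\<close> the form is the diagonal form
  \<open>M(\<gamma>\<^bsup>p-2\<^esup>x\<^sup>2 + \<delta>\<^bsup>p-2\<^esup>y\<^sup>2)\<close>.  The sum of the \<open>q\<close>-th powers of the coefficients is convex, hence at
  most its larger value at these two ends: there it is \<open>M\<^sup>q\<close> times a value of \<open>bracket\<close>, and
  at most \<open>M\<^sup>q\<close>, respectively.
  
  The points of the arc on the axes are separate: \<open>c = 0\<close> there, so \<open>t \<le> t\<^sub>1\<close> is not implied, but
  \<open>\<bar>a\<bar>, \<bar>b\<bar> \<le> M\<close> gives the bound \<open>2M\<^sup>q\<close>, and \<open>2\<close> is the value of \<open>bracket\<close> at \<open>1\<close>.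
\<close>

lemma coefficient_sum_le_nonneg:
  assumes p: "p > 2" and q: "q \<ge> p / (p - 2)" and c: "c \<ge> 0"
    and B: "\<And>\<alpha>. \<alpha> \<in> {0..1} \<Longrightarrow> bracket p q \<alpha> \<le> B"
  obtains M x\<^sub>0 y\<^sub>0 where "M \<ge> 0" "\<bar>x\<^sub>0\<bar> powr p + \<bar>y\<^sub>0\<bar> powr p = 1"
    "\<bar>a * x\<^sub>0\<^sup>2 + b * y\<^sub>0\<^sup>2 + c * x\<^sub>0 * y\<^sub>0\<bar> = M"
    "\<And>x y. \<bar>a * x\<^sup>2 + b * y\<^sup>2 + c * x * y\<bar> \<le> M * (\<bar>x\<bar> powr p + \<bar>y\<bar> powr p) powr (2 / p)"
    "\<bar>a\<bar> powr q + \<bar>b\<bar> powr q + \<bar>c\<bar> powr q \<le> B * M powr q"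
proof -
  have q1: "q \<ge> 1"
  proof -
    have "1 \<le> p / (p - 2)" using p by simp
    then show ?thesis using q by simp
  qed
  obtain \<gamma> \<delta> M \<sigma> where
    arc: "lp_arc p \<gamma> \<delta>" and \<sigma>: "\<sigma> = 1 \<or> \<sigma> = -1" and M: "M \<ge> 0" and
    eq: "\<sigma> * (a * \<gamma>\<^sup>2 + b * \<delta>\<^sup>2) + c * \<gamma> * \<delta> = M" and
    le: "\<And>x y. \<bar>a * x\<^sup>2 + b * y\<^sup>2 + c * x * y\<bar> \<le> M * (\<bar>x\<bar> powr p + \<bar>y\<bar> powr p) powr (2 / p)" and
    eqs: "2 * (\<sigma> * a) * \<gamma> + c * \<delta> = 2 * M * \<gamma> powr (p - 1)"
    "2 * (\<sigma> * b) * \<delta> + c * \<gamma> = 2 * M * \<delta> powr (p - 1)"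
    by (rule maximum_point[OF p c, of a b]) (rule that, assumption+)
  have nn: "\<gamma> \<ge> 0" "\<delta> \<ge> 0" and e: "\<gamma> powr p + \<delta> powr p = 1"
    using arc by (auto simp: lp_arc_def)
  have B2: "B \<ge> 2" using B[of 1] by (simp add: bracket_one)
  have abs_sig: "\<bar>\<sigma> * z\<bar> = \<bar>z\<bar>" for z using \<sigma> by auto
  \<comment> \<open>For \<open>\<sigma> = -1\<close> the form takes the value \<open>-M\<close> at \<open>(\<gamma>,-\<delta>)\<close>.\<close>
  have att: "\<bar>a * \<gamma>\<^sup>2 + b * (\<sigma> * \<delta>)\<^sup>2 + c * \<gamma> * (\<sigma> * \<delta>)\<bar> = M"
  proof -
    have "\<bar>a * \<gamma>\<^sup>2 + b * (\<sigma> * \<delta>)\<^sup>2 + c * \<gamma> * (\<sigma> * \<delta>)\<bar> = \<bar>\<sigma> * (a * \<gamma>\<^sup>2 + b * \<delta>\<^sup>2) + c * \<gamma> * \<delta>\<bar>"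
      using \<sigma> by auto
    then show ?thesis using eq M by simp
  qed
  have nrm: "\<bar>\<gamma>\<bar> powr p + \<bar>\<sigma> * \<delta>\<bar> powr p = 1" using nn e by (simp add: abs_sig)
  have "\<bar>a\<bar> powr q + \<bar>b\<bar> powr q + \<bar>c\<bar> powr q \<le> B * M powr q"
  proof (cases "\<gamma> = 0 \<or> \<delta> = 0")
    case True
    then have "c = 0"
    proof
      assume z: "\<gamma> = 0"
      then have "\<delta> = 1" using arc lp_arc_iff[of p \<gamma> \<delta>] p by auto
      then show ?thesis using eqs z by simp
    next
      assume z: "\<delta> = 0"
      then have "\<gamma> = 1" using lp_arc_iff[of p \<delta> \<gamma>] lp_arc_swap[OF arc] p by auto
      then show ?thesis using eqs z by simp
    qed
    moreover have "\<bar>a\<bar> powr q \<le> M powr q" "\<bar>b\<bar> powr q \<le> M powr q"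
      using le[of 1 0] le[of 0 1] q1 by (auto intro!: powr_mono2)
    ultimately have "\<bar>a\<bar> powr q + \<bar>b\<bar> powr q + \<bar>c\<bar> powr q \<le> 2 * M powr q" by simp
    also have "\<dots> \<le> B * M powr q" using B2 by (intro mult_right_mono) auto
    finally show ?thesis .
  next
    case False
    then have pos: "\<gamma> > 0" "\<delta> > 0" using nn by auto
    define A where "A = saddle_a p \<gamma> \<delta>"
    define C where "C = saddle_c p \<gamma> \<delta>"
    define s where "s = \<gamma>\<^sup>2 + \<delta>\<^sup>2"
    define g where "g = \<gamma> powr (p - 2)"
    define d where "d = \<delta> powr (p - 2)"
    have s: "s > 0" using lp_arc_sum_squares_pos[OF arc] by (simp add: s_def)
    have pp: "\<gamma> powr p = \<gamma>\<^sup>2 * g" "\<delta> powr p = \<delta>\<^sup>2 * d"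
      using powr_peel[OF nn(1), of p] powr_peel[OF nn(2), of p]
      by (simp_all add: g_def d_def power2_eq_square)
    from tangent_decomposition[OF arc eqs] obtain t where
      ta: "\<sigma> * a = M * A + t * \<delta>\<^sup>2" and tb: "\<sigma> * b = - (M * A) + t * \<gamma>\<^sup>2" and
      tc: "c = M * C - 2 * t * \<gamma> * \<delta>" and ts: "\<sigma> * a + \<sigma> * b = t * s"
      unfolding A_def C_def s_def by metis
    have "t \<ge> 0"
    proof -
      have "\<sigma> * a * \<delta>\<^sup>2 + \<sigma> * b * \<gamma>\<^sup>2 - c * \<gamma> * \<delta> \<ge> - M"
      proof -
        have "\<bar>a * \<delta>\<^sup>2 + b * (\<sigma> * \<gamma>)\<^sup>2 + c * \<delta> * (- \<sigma> * \<gamma>)\<bar> \<le> M"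
          using le[of \<delta> "- \<sigma> * \<gamma>"] \<sigma> nn e by (auto simp: add.commute)
        then show ?thesis using \<sigma> by (auto simp: algebra_simps)
      qed
      moreover have "\<sigma> * a * \<delta>\<^sup>2 + \<sigma> * b * \<gamma>\<^sup>2 - c * \<gamma> * \<delta> = - M + t * s\<^sup>2"
      proof -
        have "\<sigma> * a * \<delta>\<^sup>2 + \<sigma> * b * \<gamma>\<^sup>2 - c * \<gamma> * \<delta>
            = - M * (A * (\<gamma>\<^sup>2 - \<delta>\<^sup>2) + C * \<gamma> * \<delta>) + t * s\<^sup>2"
          unfolding ta tb s_def by (subst tc) algebra
        then show ?thesis using saddle_at_point[OF arc] by (simp add: A_def C_def)
      qed
      ultimately have "t * s\<^sup>2 \<ge> 0" by simp
      then show ?thesis using s by (simp add: zero_le_mult_iff)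
    qed
    define t\<^sub>1 where "t\<^sub>1 = M * (g + d) / s"
    have C: "M * C = 2 * t\<^sub>1 * \<gamma> * \<delta>" by (simp add: C_def saddle_c_def t\<^sub>1_def g_def d_def s_def)
    have A: "A * s = \<gamma>\<^sup>2 * g - \<delta>\<^sup>2 * d"
      using s by (simp add: A_def saddle_a_def pp flip: s_def)
    have t1: "t\<^sub>1 * s = M * (g + d)" using s by (simp add: t\<^sub>1_def)
    have "t \<le> t\<^sub>1"
    proof (rule ccontr)
      assume "\<not> t \<le> t\<^sub>1"
      then have "(t\<^sub>1 - t) * (2 * \<gamma> * \<delta>) < 0" using pos by (intro mult_neg_pos) auto
      then show False using c tc C by (simp add: algebra_simps)
    qed
    \<comment> \<open>If \<open>t\<^sub>1 = 0\<close> then \<open>t = 0\<close> as well, and \<open>l = 0\<close> by the convention for division by zero.\<close>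
    define l where "l = t / t\<^sub>1"
    have l: "0 \<le> l" "l \<le> 1" "t = l * t\<^sub>1"
      using \<open>0 \<le> t\<close> \<open>t \<le> t\<^sub>1\<close> by (auto simp: l_def divide_le_eq_1)
    have "M * g * s = (M * A + t\<^sub>1 * \<delta>\<^sup>2) * s" using A t1 s_def by algebra
    then have Mg: "M * g = M * A + t\<^sub>1 * \<delta>\<^sup>2" using s by simp
    have "M * d * s = (- (M * A) + t\<^sub>1 * \<gamma>\<^sup>2) * s" using A t1 s_def by algebra
    then have Md: "M * d = - (M * A) + t\<^sub>1 * \<gamma>\<^sup>2" using s by simp
    have la: "\<sigma> * a = (1 - l) * (M * A) + l * (M * g)" using ta l(3) Mg by algebra
    have lb: "\<sigma> * b = (1 - l) * (- (M * A)) + l * (M * d)" using tb l(3) Md by algebra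
    have lc: "c = (1 - l) * (M * C) + l * 0" using tc l(3) C by algebra
    have "\<bar>a\<bar> powr q \<le> (1 - l) * \<bar>M * A\<bar> powr q + l * \<bar>M * g\<bar> powr q"
      unfolding abs_sig[of a, symmetric] la by (rule abs_powr_convex[OF q1 l(1,2)])
    moreover have "\<bar>b\<bar> powr q \<le> (1 - l) * \<bar>- (M * A)\<bar> powr q + l * \<bar>M * d\<bar> powr q"
      unfolding abs_sig[of b, symmetric] lb by (rule abs_powr_convex[OF q1 l(1,2)])
    moreover have "\<bar>c\<bar> powr q \<le> (1 - l) * \<bar>M * C\<bar> powr q + l * \<bar>0\<bar> powr q"
      by (subst lc) (rule abs_powr_convex[OF q1 l(1,2)])
    ultimately have "\<bar>a\<bar> powr q + \<bar>b\<bar> powr q + \<bar>c\<bar> powr q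
      \<le> (1 - l) * (M powr q * (2 * \<bar>A\<bar> powr q + \<bar>C\<bar> powr q)) + l * (M powr q * (g powr q + d powr q))"
      using M by (simp add: abs_mult powr_mult g_def d_def algebra_simps)
    also have "\<dots> \<le> (1 - l) * (M powr q * B) + l * (M powr q * B)"
    proof -
      have "2 * \<bar>A\<bar> powr q + \<bar>C\<bar> powr q \<le> B"
        using B[of \<gamma>] bracket_eq_saddle[OF _ arc, of q] lp_arc_le_1[OF arc] nn p by (simp add: A_def C_def)
      moreover have "g powr q + d powr q \<le> B"
      proof -
        \<comment> \<open>This is where \<open>q \<ge> p / (p - 2)\<close> enters: it makes \<open>g\<^sup>q \<le> \<gamma>\<^sup>p\<close>.\<close>
        have "p \<le> (p - 2) * q" using q p by (simp add: pos_divide_le_eq mult.commute)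
        then have "\<gamma> powr ((p - 2) * q) \<le> \<gamma> powr p" "\<delta> powr ((p - 2) * q) \<le> \<delta> powr p"
          using nn lp_arc_le_1[OF arc] p by (auto intro!: powr_mono')
        then show ?thesis using e B2 by (simp add: g_def d_def powr_powr)
      qed
      ultimately show ?thesis using l by (intro add_mono mult_left_mono) auto
    qed
    finally show ?thesis by (simp add: algebra_simps)
  qed
  then show thesis using that[OF M nrm att le] by blast
qed

lemma coefficient_sum_le:
  assumes p: "p > 2" and q: "q \<ge> p / (p - 2)"
    and B: "\<And>\<alpha>. \<alpha> \<in> {0..1} \<Longrightarrow> bracket p q \<alpha> \<le> B"
  obtains M x\<^sub>0 y\<^sub>0 where "M \<ge> 0" "\<bar>x\<^sub>0\<bar> powr p + \<bar>y\<^sub>0\<bar> powr p = 1"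
    "\<bar>a * x\<^sub>0\<^sup>2 + b * y\<^sub>0\<^sup>2 + c * x\<^sub>0 * y\<^sub>0\<bar> = M"
    "\<And>x y. \<bar>a * x\<^sup>2 + b * y\<^sup>2 + c * x * y\<bar> \<le> M * (\<bar>x\<bar> powr p + \<bar>y\<bar> powr p) powr (2 / p)"
    "\<bar>a\<bar> powr q + \<bar>b\<bar> powr q + \<bar>c\<bar> powr q \<le> B * M powr q"
proof (cases "c \<ge> 0")
  case True
  show thesis by (rule coefficient_sum_le_nonneg[OF p q True B, of a b]) (auto intro: that)
next
  case False
  then have "- c \<ge> 0" by simp
  from coefficient_sum_le_nonneg[OF p q this B, of a b] obtain M x\<^sub>0 y\<^sub>0 where
    *: "M \<ge> 0" "\<bar>x\<^sub>0\<bar> powr p + \<bar>y\<^sub>0\<bar> powr p = 1"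
    "\<bar>a * x\<^sub>0\<^sup>2 + b * y\<^sub>0\<^sup>2 + - c * x\<^sub>0 * y\<^sub>0\<bar> = M"
    and le: "\<And>x y. \<bar>a * x\<^sup>2 + b * y\<^sup>2 + - c * x * y\<bar> \<le> M * (\<bar>x\<bar> powr p + \<bar>y\<bar> powr p) powr (2 / p)" and
    S: "\<bar>a\<bar> powr q + \<bar>b\<bar> powr q + \<bar>- c\<bar> powr q \<le> B * M powr q" by metis
  show thesis
  proof (rule that[of M x\<^sub>0 "- y\<^sub>0"])
    show "\<bar>a * x\<^sup>2 + b * y\<^sup>2 + c * x * y\<bar> \<le> M * (\<bar>x\<bar> powr p + \<bar>y\<bar> powr p) powr (2 / p)" for x y
      using le[of x "- y"] by simp
  qed (use * S in auto)
qed

section \<open>Quadratic polynomials in two variables\<close>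

definition pair_index :: "nat \<Rightarrow> nat \<Rightarrow> nat \<Rightarrow> nat" where
  "pair_index i j = (\<lambda>k. if k = 0 then i else if k = 1 then j else 0)"

lemma pair_index_simps [simp]: "pair_index i j 0 = i" "pair_index i j (Suc 0) = j"
  by (simp_all add: pair_index_def)

lemma pair_index_eq_iff [simp]: "pair_index i j = pair_index k l \<longleftrightarrow> i = k \<and> j = l"
  by (metis pair_index_simps)

lemma multi_indices2_2: "multi_indices2 2 = {pair_index 2 0, pair_index 0 2, pair_index 1 1}"
proof (intro equalityI subsetI)
  fix \<alpha> assume "\<alpha> \<in> multi_indices2 2"
  then have *: "\<forall>i\<ge>2. \<alpha> i = 0" "\<alpha> 0 + \<alpha> 1 = 2"
    by (auto simp: multi_indices2_def numeral_2_eq_2)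
  then have "\<alpha> = pair_index (\<alpha> 0) (\<alpha> 1)"
    by (auto simp: pair_index_def fun_eq_iff)
  moreover have "\<alpha> 0 = 2 \<and> \<alpha> 1 = 0 \<or> \<alpha> 0 = 0 \<and> \<alpha> 1 = 2 \<or> \<alpha> 0 = 1 \<and> \<alpha> 1 = 1"
    using *(2) by arith
  ultimately show "\<alpha> \<in> {pair_index 2 0, pair_index 0 2, pair_index 1 1}" by auto
next
  fix \<alpha> assume "\<alpha> \<in> {pair_index 2 0, pair_index 0 2, pair_index 1 1}"
  then show "\<alpha> \<in> multi_indices2 2"
    by (auto simp: multi_indices2_def pair_index_def numeral_2_eq_2)
qed

lemma poly2_eval_2:
  "poly2_eval 2 a x = a (pair_index 2 0) * (x 0)\<^sup>2 + a (pair_index 0 2) * (x 1)\<^sup>2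
     + a (pair_index 1 1) * x 0 * x 1"
proof -
  have "{..<2::nat} = {0, 1}" by auto
  then show ?thesis by (simp add: poly2_eval_def multi_indices2_2 algebra_simps)
qed

lemma coeff_norm_2:
  "coeff_norm 2 q a = (\<bar>a (pair_index 2 0)\<bar> powr q + \<bar>a (pair_index 0 2)\<bar> powr q
     + \<bar>a (pair_index 1 1)\<bar> powr q) powr (1 / q)"
  by (simp add: coeff_norm_def multi_indices2_2 add.assoc)

lemma lp_norm_2: "lp_norm 2 (ereal p) x = (\<bar>x 0\<bar> powr p + \<bar>x 1\<bar> powr p) powr (1 / p)"
  by (simp add: lp_norm_def numeral_2_eq_2)

lemma poly2_norm_2_eqI:
  assumes p: "p > 0" and M: "M \<ge> 0" and att: "\<bar>x\<^sub>0\<bar> powr p + \<bar>y\<^sub>0\<bar> powr p = 1"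
    "\<bar>a (pair_index 2 0) * x\<^sub>0\<^sup>2 + a (pair_index 0 2) * y\<^sub>0\<^sup>2 + a (pair_index 1 1) * x\<^sub>0 * y\<^sub>0\<bar> = M"
    and le: "\<And>x y. \<bar>a (pair_index 2 0) * x\<^sup>2 + a (pair_index 0 2) * y\<^sup>2 + a (pair_index 1 1) * x * y\<bar>
      \<le> M * (\<bar>x\<bar> powr p + \<bar>y\<bar> powr p) powr (2 / p)"
  shows "poly2_norm 2 (ereal p) a = M"
  unfolding poly2_norm_def
proof (rule cSup_eq_maximum)
  let ?x = "\<lambda>i::nat. if i = 0 then x\<^sub>0 else y\<^sub>0"
  have "lp_norm 2 (ereal p) ?x \<le> 1" using att(1) by (simp add: lp_norm_2)
  moreover have "M = \<bar>poly2_eval 2 a ?x\<bar>" using att(2) by (simp add: poly2_eval_2)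
  ultimately show "M \<in> (\<lambda>x. \<bar>poly2_eval 2 a x\<bar>) ` {x. lp_norm 2 (ereal p) x \<le> 1}" by blast
next
  fix v assume "v \<in> (\<lambda>x. \<bar>poly2_eval 2 a x\<bar>) ` {x. lp_norm 2 (ereal p) x \<le> 1}"
  then obtain x where x: "lp_norm 2 (ereal p) x \<le> 1" and v: "v = \<bar>poly2_eval 2 a x\<bar>" by auto
  have "v \<le> M * (\<bar>x 0\<bar> powr p + \<bar>x 1\<bar> powr p) powr (2 / p)"
    using le by (simp add: v poly2_eval_2)
  also have "(\<bar>x 0\<bar> powr p + \<bar>x 1\<bar> powr p) powr (2 / p) = (lp_norm 2 (ereal p) x)\<^sup>2"
    using powr_powr[of "\<bar>x 0\<bar> powr p + \<bar>x 1\<bar> powr p" "1 / p" 2] by (simp add: lp_norm_2)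
  also have "M * (lp_norm 2 (ereal p) x)\<^sup>2 \<le> M * 1"
    using x M by (intro mult_left_mono power_le_one) (auto simp: lp_norm_2)
  finally show "v \<le> M" by simp
qed

lemma lp_norm_2_le_1D:
  assumes p: "p > (2::ereal)" and x: "lp_norm 2 p x \<le> 1"
  shows "\<bar>x 0\<bar> \<le> 1" "\<bar>x 1\<bar> \<le> 1"
proof -
  have "\<bar>x 0\<bar> \<le> 1 \<and> \<bar>x 1\<bar> \<le> 1"
  proof (cases p)
    case (real r)
    then have r: "r > 0" using p by (simp flip: ereal_less(1))
    have *: "z \<le> w powr (1 / r)" if "0 \<le> z" "z powr r \<le> w" for z w :: real
      using powr_mono2[of "1 / r" "z powr r" w] that r by (simp add: powr_powr)
    have "\<bar>x 0\<bar> \<le> lp_norm 2 p x" "\<bar>x 1\<bar> \<le> lp_norm 2 p x"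
      unfolding real lp_norm_2 by (intro *; simp)+
    then show ?thesis using x by linarith
  next
    case PInf
    then show ?thesis using x by (auto simp: lp_norm_def numeral_2_eq_2 lessThan_Suc)
  next
    case MInf
    then show ?thesis using p by simp
  qed
  then show "\<bar>x 0\<bar> \<le> 1" "\<bar>x 1\<bar> \<le> 1" by auto
qed

lemma poly2_norm_2_nonneg:
  assumes p: "p > 2"
  shows "poly2_norm 2 p a \<ge> 0"
proof -
  let ?X = "{x. lp_norm 2 p x \<le> 1}"
  let ?f = "\<lambda>x. \<bar>poly2_eval 2 a x\<bar>"
  let ?b = "\<bar>a (pair_index 2 0)\<bar> + \<bar>a (pair_index 0 2)\<bar> + \<bar>a (pair_index 1 1)\<bar>"
  have "?f x \<le> ?b" if "x \<in> ?X" for x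
  proof -
    have x: "\<bar>x 0\<bar> \<le> 1" "\<bar>x 1\<bar> \<le> 1" using lp_norm_2_le_1D[OF p] that by auto
    have m: "\<bar>k * u * v\<bar> \<le> \<bar>k\<bar>" if "\<bar>u\<bar> \<le> 1" "\<bar>v\<bar> \<le> 1" for k u v :: real
      using that mult_left_mono[of "\<bar>u * v\<bar>" 1 "\<bar>k\<bar>"]
      by (simp add: abs_mult mult_le_one mult.assoc)
    show ?thesis
      using m[OF x(1) x(1), of "a (pair_index 2 0)"] m[OF x(2) x(2), of "a (pair_index 0 2)"]
        m[OF x, of "a (pair_index 1 1)"]
      unfolding poly2_eval_2 power2_eq_square mult.assoc by linarith
  qed
  then have bdd: "bdd_above (?f ` ?X)" by (auto simp: bdd_above_def)
  have "(\<lambda>_. 0) \<in> ?X" by (simp add: lp_norm_def numeral_2_eq_2 lessThan_Suc)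
  from cSUP_upper[OF this bdd] have "\<bar>poly2_eval 2 a (\<lambda>_. 0)\<bar> \<le> poly2_norm 2 p a"
    unfolding poly2_norm_def .
  then show ?thesis by linarith
qed

text \<open>
  The positivity required of \<open>K\<close> in \<open>K2\<close> is automatic, since some polynomial has positive
  coefficient norm and no polynomial has negative norm.
\<close>

lemma K2_eq_LEAST:
  assumes p: "p > 2"
  shows "K2 q p = (LEAST K. \<forall>a. coeff_norm 2 q a \<le> K * poly2_norm 2 p a)"
proof -
  have "K > 0" if "\<forall>a. coeff_norm 2 q a \<le> K * poly2_norm 2 p a" for K
  proof (rule ccontr)
    assume "\<not> K > 0"
    then have "K * poly2_norm 2 p (\<lambda>_. 1) \<le> 0"
      using poly2_norm_2_nonneg[OF p] by (simp add: mult_le_0_iff)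
    moreover have "coeff_norm 2 q (\<lambda>_. 1) > 0" by (simp add: coeff_norm_2)
    ultimately show False using that by (meson less_le_not_le order.trans)
  qed
  then show ?thesis unfolding K2_def by (metis (no_types, lifting))
qed

section \<open>The constant for two variables\<close>

lemma continuous_on_bracket:
  assumes p: "p > 2" and q: "q > 0"
  shows "continuous_on {0..1} (bracket p q)"
proof -
  have c1: "continuous_on {0..1} (\<lambda>t::real. t powr r)" if "r > 0" for r
    by (rule continuous_on_powr_unit[OF that zero_less_one])
  have c2: "continuous_on {0..1} (\<lambda>t::real. (1 - t powr p) powr e)" if "e > 0" for e
    using p by (intro continuous_on_powr_unit that) simp
  have den: "\<alpha>\<^sup>2 + (1 - \<alpha> powr p) powr (2 / p) > 0" if "\<alpha> \<in> {0..1}" for \<alpha>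
  proof -
    have "lp_arc p \<alpha> ((1 - \<alpha> powr p) powr (1 / p))" using that p by (simp add: lp_arc_iff)
    from lp_arc_sum_squares_pos[OF this] show ?thesis
      using powr_powr[of "1 - \<alpha> powr p" "1 / p" 2] by simp
  qed
  have cp: "continuous_on {0..1} (\<lambda>\<alpha>. f \<alpha> powr q)"
    if "continuous_on {0..1} f" "\<And>\<alpha>. \<alpha> \<in> {0..1} \<Longrightarrow> f \<alpha> \<ge> 0" for f :: "real \<Rightarrow> real"
    by (rule continuous_on_powr'[OF that(1) continuous_on_const]) (use that(2) q in auto)
  have den0: "\<forall>\<alpha>\<in>{0..1}. \<alpha>\<^sup>2 + (1 - \<alpha> powr p) powr (2 / p) \<noteq> 0" using den by fastforce
  show ?thesis
    unfolding bracket_def[abs_def]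
  proof (intro continuous_on_add continuous_on_mult[OF continuous_on_const] cp)
    show "continuous_on {0..1} (\<lambda>\<alpha>. \<bar>(2 * \<alpha> powr p - 1) / (\<alpha>\<^sup>2 + (1 - \<alpha> powr p) powr (2 / p))\<bar>)"
      using p den0
      by (intro continuous_on_add continuous_on_diff continuous_on_rabs continuous_on_mult
          continuous_on_divide continuous_on_power continuous_on_const continuous_on_id c1 c2) simp_all
    show "continuous_on {0..1} (\<lambda>\<alpha>. 2 * \<alpha> * (1 - \<alpha> powr p) powr (1 / p)
        * ((\<alpha> powr (p - 2) + (1 - \<alpha> powr p) powr ((p - 2) / p))
            / (\<alpha>\<^sup>2 + (1 - \<alpha> powr p) powr (2 / p))))"
      using p den0
      by (intro continuous_on_add continuous_on_diff continuous_on_rabs continuous_on_mult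
          continuous_on_divide continuous_on_power continuous_on_const continuous_on_id c1 c2) simp_all
  qed (use den in \<open>auto intro!: mult_nonneg_nonneg divide_nonneg_pos\<close>)
qed

text \<open>
  The upper bound is \<open>coefficient_sum_le\<close>.  It is attained by the saddle form at a point where
  \<open>bracket\<close> is maximal: that form has norm \<open>1\<close>.
\<close>

lemma K2_is_max:
  assumes p: "p > 2" and q: "q \<ge> p / (p - 2)"
  shows "is_max_on (\<lambda>\<alpha>. bracket p q \<alpha> powr (1 / q)) {0..1} (K2 q (ereal p))"
proof -
  have "p / (p - 2) > 0" using p by simp
  then have q0: "q > 0" using q by simp
  from continuous_attains_sup[OF _ _ continuous_on_bracket[OF p q0]] obtain \<alpha> where
    \<alpha>: "\<alpha> \<in> {0..1}" and max: "\<And>t. t \<in> {0..1} \<Longrightarrow> bracket p q t \<le> bracket p q \<alpha>" by auto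
  define \<beta> where "\<beta> = (1 - \<alpha> powr p) powr (1 / p)"
  define B where "B = bracket p q \<alpha>"
  have arc: "lp_arc p \<alpha> \<beta>" using \<alpha> p by (simp add: lp_arc_iff \<beta>_def)
  have B0: "B \<ge> 0" using bracket_eq_saddle[OF _ arc, of q] p by (simp add: B_def)
  have "K2 q (ereal p) = B powr (1 / q)"
    unfolding K2_eq_LEAST[of "ereal p", simplified, OF p]
  proof (rule Least_equality)
    show "\<forall>a. coeff_norm 2 q a \<le> B powr (1 / q) * poly2_norm 2 (ereal p) a"
    proof
      fix a :: "(nat \<Rightarrow> nat) \<Rightarrow> real"
      obtain M x\<^sub>0 y\<^sub>0 where *: "M \<ge> 0" "\<bar>x\<^sub>0\<bar> powr p + \<bar>y\<^sub>0\<bar> powr p = 1"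
        "\<bar>a (pair_index 2 0) * x\<^sub>0\<^sup>2 + a (pair_index 0 2) * y\<^sub>0\<^sup>2 + a (pair_index 1 1) * x\<^sub>0 * y\<^sub>0\<bar> = M"
        "\<And>x y. \<bar>a (pair_index 2 0) * x\<^sup>2 + a (pair_index 0 2) * y\<^sup>2 + a (pair_index 1 1) * x * y\<bar>
          \<le> M * (\<bar>x\<bar> powr p + \<bar>y\<bar> powr p) powr (2 / p)" and
        S: "\<bar>a (pair_index 2 0)\<bar> powr q + \<bar>a (pair_index 0 2)\<bar> powr q
          + \<bar>a (pair_index 1 1)\<bar> powr q \<le> B * M powr q"
        using coefficient_sum_le[OF p q max[folded B_def], of "a (pair_index 2 0)"
            "a (pair_index 0 2)" "a (pair_index 1 1)"] by metis
      have M: "poly2_norm 2 (ereal p) a = M"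
        using * p by (intro poly2_norm_2_eqI[of p M x\<^sub>0 y\<^sub>0]) auto
      have "coeff_norm 2 q a \<le> (B * M powr q) powr (1 / q)"
        unfolding coeff_norm_2 using S q0 by (intro powr_mono2) auto
      also have "\<dots> = B powr (1 / q) * M"
        using B0 \<open>M \<ge> 0\<close> q0 by (simp add: powr_mult powr_powr)
      finally show "coeff_norm 2 q a \<le> B powr (1 / q) * poly2_norm 2 (ereal p) a" by (simp add: M)
    qed
  next
    fix K assume K: "\<forall>a. coeff_norm 2 q a \<le> K * poly2_norm 2 (ereal p) a"
    define a where "a = (\<lambda>i. if i = pair_index 2 0 then saddle_a p \<alpha> \<beta>
      else if i = pair_index 0 2 then - saddle_a p \<alpha> \<beta> else saddle_c p \<alpha> \<beta>)"
    have a: "a (pair_index 2 0) = saddle_a p \<alpha> \<beta>" "a (pair_index 0 2) = - saddle_a p \<alpha> \<beta>"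
      "a (pair_index 1 1) = saddle_c p \<alpha> \<beta>" by (simp_all add: a_def)
    have "poly2_norm 2 (ereal p) a = 1"
    proof (rule poly2_norm_2_eqI[of p 1 \<alpha> \<beta>])
      show "\<bar>\<alpha>\<bar> powr p + \<bar>\<beta>\<bar> powr p = 1" using arc by (simp add: lp_arc_def)
      show "\<bar>a (pair_index 2 0) * \<alpha>\<^sup>2 + a (pair_index 0 2) * \<beta>\<^sup>2 + a (pair_index 1 1) * \<alpha> * \<beta>\<bar> = 1"
        using saddle_at_point[OF arc] unfolding a by (simp add: algebra_simps)
      show "\<bar>a (pair_index 2 0) * x\<^sup>2 + a (pair_index 0 2) * y\<^sup>2 + a (pair_index 1 1) * x * y\<bar>
          \<le> 1 * (\<bar>x\<bar> powr p + \<bar>y\<bar> powr p) powr (2 / p)" for x y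
        using saddle_norm_le[OF p arc] unfolding a by simp
    qed (use p in auto)
    moreover have "coeff_norm 2 q a = B powr (1 / q)"
      using bracket_eq_saddle[OF _ arc, of q] p unfolding coeff_norm_2 a B_def by simp
    ultimately show "B powr (1 / q) \<le> K" using K by (metis mult.right_neutral)
  qed
  moreover have "bracket p q t powr (1 / q) \<le> B powr (1 / q)" if "t \<in> {0..1}" for t
  proof (rule powr_mono2)
    have "lp_arc p t ((1 - t powr p) powr (1 / p))" using that p by (simp add: lp_arc_iff)
    from bracket_eq_saddle[OF _ this, of q] show "0 \<le> bracket p q t" using p by simp
  qed (use max[OF that] q0 in \<open>auto simp: B_def\<close>)
  ultimately show ?thesis using \<alpha> by (auto simp: is_max_on_def B_def)
qed

theorem theorem4p1:
  fixes p :: ereal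
  assumes "p > 2"
  shows "(p \<le> 4 \<longrightarrow>
            C2 p \<ge> ereal (C2_dim p 2) \<and>
            C2_dim p 2 = K2 (C_exponent p) p \<and>
            (\<forall>r::real. p = ereal r \<longrightarrow>
              is_max_on (\<lambda>\<alpha>. bracket r (r / (r - 2)) \<alpha> powr ((r - 2) / r)) {0..1}
                (K2 (r / (r - 2)) p)))
       \<and> (p \<ge> 4 \<longrightarrow>
            D2 p \<ge> ereal (D2_dim p 2) \<and>
            D2_dim p 2 = K2 (D_exponent p) p \<and>
            (\<forall>r::real. p = ereal r \<longrightarrow>
              is_max_on (\<lambda>\<alpha>. bracket r (4 * r / (3 * r - 4)) \<alpha> powr ((3 * r - 4) / (4 * r))) {0..1}
                (K2 (4 * r / (3 * r - 4)) p)))"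
proof -
  have "C2 p \<ge> ereal (C2_dim p 2)" "D2 p \<ge> ereal (D2_dim p 2)"
    unfolding C2_def D2_def by (auto intro: SUP_upper)
  moreover have "C2_dim p 2 = K2 (C_exponent p) p" "D2_dim p 2 = K2 (D_exponent p) p"
    by (simp_all add: C2_dim_def D2_dim_def K2_eq_LEAST[OF assms])
  moreover have "is_max_on (\<lambda>\<alpha>. bracket r (r / (r - 2)) \<alpha> powr ((r - 2) / r)) {0..1}
      (K2 (r / (r - 2)) p)" if "p = ereal r" for r
    using K2_is_max[of r "r / (r - 2)"] that assms by simp
  moreover have "is_max_on (\<lambda>\<alpha>. bracket r (4 * r / (3 * r - 4)) \<alpha> powr ((3 * r - 4) / (4 * r))) {0..1}
      (K2 (4 * r / (3 * r - 4)) p)" if "p = ereal r" "p \<ge> 4" for r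
  proof -
    have r: "r \<ge> 4" using that by simp
    \<comment> \<open>Equivalent to \<open>r \<ge> 4\<close>; at \<open>r = 4\<close> both exponents are \<open>2\<close>.\<close>
    have "r / (r - 2) \<le> 4 * r / (3 * r - 4)"
      using r mult_left_mono[of 4 r r] by (simp add: field_simps)
    then show ?thesis using K2_is_max[of r "4 * r / (3 * r - 4)"] that(1) r by simp
  qed
  ultimately show ?thesis by blast
qed

end
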